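(* Let $(X,\tau,\mathcal{I})$ be an ideal topological space and $A\subseteq X$. Then $A$ is a dense set in $X$ (with respect to $\tau$) if and only if $(X,\tau,Ann_A)$ is a Hayashi-Samuel space.
   Context: An ideal on a set $X$ is a non-empty family $\mathcal{I}\subseteq 2^X$ ($2^X$ is the power set of $X$) closed under taking subsets and finite unions. An ideal topological space $(X,\tau,\mathcal{I})$ is a topological space $(X,\tau)$ together with an ideal $\mathcal{I}$ on $X$. It is called a Hayashi-Samuel space if $\tau\cap\mathcal{I}=\{\emptyset\}$. For $A\subseteq X$, $Ann_A=\{B\subseteq X\mid A\cap B=\emptyset\}$, which is an ideal on $X$. *)

theory Defs
  imports "HOL-Analysis.Abstract_Topology"
begin

text \<open>Ideals of subsets, over an explicit ground set \<open>X\<close>; as in the source, \<open>X \<in> \<I>\<close> is allowed.\<close>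

definition set_ideal :: "'a set \<Rightarrow> 'a set set \<Rightarrow> bool" where
  "set_ideal X \<I> \<longleftrightarrow>
     \<I> \<subseteq> Pow X \<and> \<I> \<noteq> {} \<and>
     (\<forall>B\<in>\<I>. \<forall>C. C \<subseteq> B \<longrightarrow> C \<in> \<I>) \<and>
     (\<forall>B\<in>\<I>. \<forall>C\<in>\<I>. B \<union> C \<in> \<I>)"

definition ideal_topological_space :: "'a topology \<Rightarrow> 'a set set \<Rightarrow> bool" where
  "ideal_topological_space \<tau> \<I> \<longleftrightarrow> set_ideal (topspace \<tau>) \<I>"

definition hayashi_samuel_space :: "'a topology \<Rightarrow> 'a set set \<Rightarrow> bool" where
  "hayashi_samuel_space \<tau> \<I> \<longleftrightarrow>
     ideal_topological_space \<tau> \<I> \<and> {U. openin \<tau> U} \<inter> \<I> = {{}}"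

definition Ann :: "'a set \<Rightarrow> 'a set \<Rightarrow> 'a set set" where
  "Ann X A = {B. B \<subseteq> X \<and> A \<inter> B = {}}"

definition dense_subset :: "'a topology \<Rightarrow> 'a set \<Rightarrow> bool" where
  "dense_subset \<tau> A \<longleftrightarrow> A \<subseteq> topspace \<tau> \<and> \<tau> closure_of A = topspace \<tau>"

end

theory Submission
  imports Defs
begin

text \<open>
  A set is dense exactly when it meets every nonempty open set (\<open>dense_intersects_open\<close>), that is,
  when no nonempty open set lies in its annihilator. Since the annihilator is an ideal containing
  the empty set (\<open>ideal_topological_space_Ann\<close>), this is precisely the Hayashi-Samuel condition.
\<close>

lemma ideal_topological_space_Ann: "ideal_topological_space \<tau> (Ann (topspace \<tau>) A)"
  unfolding ideal_topological_space_def set_ideal_def Ann_def by blast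

theorem theorem5p11:
  fixes \<tau> :: "'a topology" and \<I> :: "'a set set" and A :: "'a set"
  assumes "ideal_topological_space \<tau> \<I>"
    and "A \<subseteq> topspace \<tau>"
  shows "dense_subset \<tau> A \<longleftrightarrow> hayashi_samuel_space \<tau> (Ann (topspace \<tau>) A)"
proof -
  have "dense_subset \<tau> A \<longleftrightarrow> (\<forall>U. openin \<tau> U \<and> U \<noteq> {} \<longrightarrow> A \<inter> U \<noteq> {})"
    using assms(2) by (simp add: dense_subset_def dense_intersects_open)
  also have "\<dots> \<longleftrightarrow> {U. openin \<tau> U} \<inter> Ann (topspace \<tau>) A = {{}}"
    using openin_subset[of \<tau>] openin_empty[of \<tau>] unfolding Ann_def by blast
  also have "\<dots> \<longleftrightarrow> hayashi_samuel_space \<tau> (Ann (topspace \<tau>) A)"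
    by (simp add: hayashi_samuel_space_def ideal_topological_space_Ann)
  finally show ?thesis .
qed

end
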